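(* Let $\triangle_1$ be the Kendall convolution and $\{X_n:n\in\mathbb{N}\}$ be a random walk under $\triangle_1$ with unit step distribution $\delta_1$. Then $$P(X_{k+1}-X_k<w)=1-\frac{2}{k+1}\,\mathbb{E}\bigl((1+wY)^{-2}\bigr)$$ for every $k\in\mathbb{N}$, where $Y$ has distribution $\beta_{3,k-1}$, which means that the increments of this chain are not stationary in time.
   Context: $\mathbb{N}=\{1,2,\dots\}$. $\beta_{a,b}$ ($a,b>0$) is the Beta distribution with density $\frac{\Gamma(a+b)}{\Gamma(a)\Gamma(b)}x^{a-1}(1-x)^{b-1}\mathbf{1}_{(0,1)}(x)$. $T_b\lambda$ denotes the law of $b\theta$ for $\theta\sim\lambda$. $\pi_2$ is the Pareto distribution with density $2x^{-3}\mathbf{1}_{(1,\infty)}(x)$. The Kendall convolution $\triangle_1$ is the commutative, associative operation on Borel probability measures on $[0,\infty)$ determined by $$\delta_a\triangle_1\delta_b=\Bigl(1-\frac ab\Bigr)\delta_b+\frac ab\,T_b\pi_2\quad(0\le a\le b,\ b>0),\qquad\delta_0\triangle_1\delta_0=\delta_0,$$ and $(\lambda_1\triangle_1\lambda_2)(A)=\int\!\int(\delta_x\triangle_1\delta_y)(A)\,\lambda_1(dx)\lambda_2(dy)$. The random walk under $\triangle_1$ with unit step distribution $\delta_1$ is the Markov chain with $X_0=0$ and transition probabilities $P(X_n\in A\mid X_k=x)=\bigl(\delta_x\triangle_1\delta_1^{\triangle_1(n-k)}\bigr)(A)$ for $k<n$; in particular $X_1\sim\delta_1$. The increments are the ordinary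 differences $X_{k+1}-X_k$.
   Formalization: The formula is stated for w > 0 only (for k = 2, w = 0 the left side is 0 but the right side is 1/3), and for k = 1 the undefined distribution β_{3,0} is read as the point mass δ_1. *)

theory Defs
  imports "HOL-Probability.Probability"
begin

section \<open>Distributions\<close>

text \<open>
  The boundary value at \<open>b = 0\<close> is the weak limit of \<open>\<beta>\<close> with parameters \<open>a, b\<close> as \<open>b \<rightarrow> 0\<close> from
  above, the point mass at \<open>1\<close>. It is needed because the parameters \<open>3, k - 1\<close> with \<open>k = 1\<close> occur.
\<close>

definition beta_law :: "real \<Rightarrow> real \<Rightarrow> real measure" where
  "beta_law a b =
    (if b = 0 then return borel 1
     else density lborel (\<lambda>x. ennreal (Gamma (a + b) / (Gamma a * Gamma b)
            * x powr (a - 1) * (1 - x) powr (b - 1)) * indicator {0<..<1} x))"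

definition pareto2 :: "real measure" where
  "pareto2 = density lborel (\<lambda>x. ennreal (2 * x powr (-3)) * indicator {1<..} x)"

definition scale_law :: "real \<Rightarrow> real measure \<Rightarrow> real measure" where
  "scale_law b \<mu> = distr \<mu> borel (\<lambda>x. b * x)"

definition mix_law :: "real \<Rightarrow> 'a measure \<Rightarrow> 'a measure \<Rightarrow> 'a measure" where
  "mix_law p \<mu> \<nu> = measure_of (space \<mu>) (sets \<mu>)
     (\<lambda>A. ennreal (1 - p) * emeasure \<mu> A + ennreal p * emeasure \<nu> A)"

section \<open>Kendall convolution\<close>

text \<open>
  Probability measures on \<open>[0,\<infinity>)\<close> are Borel measures on the reals that are concentrated there;
  the values of \<open>kendall_point\<close> at negative arguments are irrelevant.
\<close>

definition kendall_point :: "real \<Rightarrow> real \<Rightarrow> real measure" where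
  "kendall_point x y =
    (let a = min x y; b = max x y in
     if 0 \<le> a \<and> 0 < b then mix_law (a / b) (return borel b) (scale_law b pareto2)
     else return borel 0)"

definition kendall_conv :: "real measure \<Rightarrow> real measure \<Rightarrow> real measure" where
  "kendall_conv \<mu> \<nu> = \<mu> \<bind> (\<lambda>x. \<nu> \<bind> (\<lambda>y. kendall_point x y))"

text \<open>The empty power is the point mass at \<open>0\<close>, the neutral element of the convolution.\<close>

primrec kendall_power :: "real measure \<Rightarrow> nat \<Rightarrow> real measure" where
  "kendall_power \<mu> 0 = return borel 0"
| "kendall_power \<mu> (Suc n) = kendall_conv (kendall_power \<mu> n) \<mu>"

section \<open>Random walks\<close>

definition past :: "'a measure \<Rightarrow> (nat \<Rightarrow> 'a \<Rightarrow> real) \<Rightarrow> nat \<Rightarrow> 'a measure" where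
  "past M X k = sigma (space M) {X i -` B \<inter> space M | i B. i \<le> k \<and> B \<in> sets borel}"

text \<open>
  The Markov property and the transition probabilities are stated together: the conditional
  probability of \<open>X\<^sub>n \<in> A\<close> given \<open>X\<^sub>0, \<dots>, X\<^sub>k\<close> is a function of \<open>X\<^sub>k\<close> alone.
\<close>

definition kendall_random_walk ::
    "'a measure \<Rightarrow> real measure \<Rightarrow> (nat \<Rightarrow> 'a \<Rightarrow> real) \<Rightarrow> bool" where
  "kendall_random_walk M step X \<longleftrightarrow>
     prob_space M \<and>
     (\<forall>n. X n \<in> borel_measurable M) \<and>
     (AE \<omega> in M. X 0 \<omega> = 0) \<and>
     (\<forall>k n. \<forall>A \<in> sets borel. k < n \<longrightarrow>
        (AE \<omega> in M.
           real_cond_exp M (past M X k) (indicator (X n -` A \<inter> space M)) \<omega> =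
           measure (kendall_conv (return borel (X k \<omega>)) (kendall_power step (n - k))) A))"

definition increment_law :: "'a measure \<Rightarrow> (nat \<Rightarrow> 'a \<Rightarrow> real) \<Rightarrow> nat \<Rightarrow> real measure" where
  "increment_law M X k = distr M borel (\<lambda>\<omega>. X (k + 1) \<omega> - X k \<omega>)"

text \<open>
  Only times \<open>k \<ge> 1\<close> are compared, so the deterministic step from \<open>X\<^sub>0 = 0\<close> plays no role.
\<close>

definition stationary_increments :: "'a measure \<Rightarrow> (nat \<Rightarrow> 'a \<Rightarrow> real) \<Rightarrow> bool" where
  "stationary_increments M X \<longleftrightarrow>
     (\<forall>j\<ge>1. \<forall>k\<ge>1. increment_law M X j = increment_law M X k)"

section \<open>The definitions denote the intended measures\<close>

text \<open>
  \<open>measure_of\<close> and \<open>bind\<close> collapse silently when their side conditions fail; the following facts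
  show that they hold here.
\<close>

lemma sets_mix_law [simp]: "sets (mix_law p \<mu> \<nu>) = sets \<mu>"
  and space_mix_law [simp]: "space (mix_law p \<mu> \<nu>) = space \<mu>"
  by (simp_all add: mix_law_def)

lemma emeasure_mix_law:
  assumes "sets \<nu> = sets \<mu>" "A \<in> sets \<mu>"
  shows "emeasure (mix_law p \<mu> \<nu>) A = ennreal (1 - p) * emeasure \<mu> A + ennreal p * emeasure \<nu> A"
proof (rule emeasure_measure_of[OF mix_law_def])
  show "sets \<mu> \<subseteq> Pow (space \<mu>)" by (rule sets.space_closed)
  show "A \<in> sets (mix_law p \<mu> \<nu>)" using assms by simp
  show "positive (sets (mix_law p \<mu> \<nu>))
      (\<lambda>A. ennreal (1 - p) * emeasure \<mu> A + ennreal p * emeasure \<nu> A)"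
    by (simp add: positive_def)
  show "countably_additive (sets (mix_law p \<mu> \<nu>))
      (\<lambda>A. ennreal (1 - p) * emeasure \<mu> A + ennreal p * emeasure \<nu> A)"
  proof (rule countably_additiveI)
    fix F :: "nat \<Rightarrow> 'a set"
    assume "range F \<subseteq> sets (mix_law p \<mu> \<nu>)" and d: "disjoint_family F"
    then have F: "range F \<subseteq> sets \<mu>" "range F \<subseteq> sets \<nu>" using assms(1) by auto
    show "(\<Sum>i. ennreal (1 - p) * emeasure \<mu> (F i) + ennreal p * emeasure \<nu> (F i)) =
        ennreal (1 - p) * emeasure \<mu> (\<Union> (range F)) + ennreal p * emeasure \<nu> (\<Union> (range F))"
      by (subst suminf_add[symmetric])
         (auto simp: ennreal_suminf_cmult suminf_emeasure[OF F(1) d] suminf_emeasure[OF F(2) d])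
  qed
qed

lemma prob_space_density_lborel:
  assumes "f \<in> borel_measurable lborel" "integral\<^sup>N lborel f = 1"
  shows "prob_space (density lborel f)"
  using assms by (intro prob_spaceI) (simp add: emeasure_density)

lemma sets_pareto2 [simp, measurable_cong]: "sets pareto2 = sets borel"
  and space_pareto2 [simp]: "space pareto2 = UNIV"
  by (simp_all add: pareto2_def)

lemma prob_space_pareto2: "prob_space pareto2"
  unfolding pareto2_def
proof (rule prob_space_density_lborel)
  show "(\<lambda>x::real. ennreal (2 * x powr (-3)) * indicator {1<..} x) \<in> borel_measurable lborel"
    by measurable
  have "(\<integral>\<^sup>+x. ennreal (2 * x powr (-3)) * indicator {1<..} x \<partial>lborel) =
      (\<integral>\<^sup>+x. ennreal (2 * (x::real) powr (-3)) * indicator {1..} x \<partial>lborel)"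
    by (rule nn_integral_cong_AE, rule AE_mp[OF AE_lborel_singleton[of 1]], rule AE_I2)
       (simp add: indicator_def)
  also have "\<dots> = ennreal (0 - (- (1 powr (-2))))"
  proof (rule nn_integral_FTC_atLeast)
    show "((\<lambda>x::real. - (x powr (-2))) has_real_derivative 2 * x powr (-3)) (at x)" if "1 \<le> x" for x
    proof (rule DERIV_cong[OF DERIV_minus[OF has_real_derivative_powr[of x "-2"]]])
      show "0 < x" using that by linarith
    qed simp
    show "((\<lambda>x::real. - (x powr (-2))) \<longlongrightarrow> 0) at_top"
    proof (rule tendsto_eq_rhs[OF tendsto_minus[OF tendsto_neg_powr[of "-2" "\<lambda>x::real. x" at_top]]])
      show "filterlim (\<lambda>x::real. x) at_top at_top" by (rule filterlim_ident)
    qed simp_all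
    show "(\<lambda>x::real. 2 * x powr (-3)) \<in> borel_measurable borel" by measurable
    show "0 \<le> 2 * x powr (-3)" for x :: real by simp
  qed
  finally show "(\<integral>\<^sup>+x. ennreal (2 * x powr (-3)) * indicator {1<..} x \<partial>lborel) = 1"
    by simp
qed

lemma prob_space_beta_law:
  assumes "0 < a" "0 \<le> b"
  shows "prob_space (beta_law a b)"
proof (cases "b = 0")
  case True
  then show ?thesis by (simp add: beta_law_def prob_space_return)
next
  case False
  with assms have b: "0 < b" by simp
  define c where "c = Gamma (a + b) / (Gamma a * Gamma b)"
  have c: "0 < c" "c * Beta a b = 1"
    using assms(1) b by (auto simp: c_def Beta_def Gamma_real_pos less_imp_neq[symmetric])
  define f where "f x = c * x powr (a - 1) * (1 - x) powr (b - 1)" for x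
  have f0: "0 \<le> f x" for x
    using c(1) by (simp add: f_def)
  have "(f has_integral 1) {0..1}"
    using has_integral_mult_right[OF has_integral_Beta_real[OF assms(1) b], of c]
    by (simp only: c(2) f_def[abs_def] mult.assoc)
  then have "(\<integral>\<^sup>+x. ennreal (f x) * indicator {0..1} x \<partial>lborel) = ennreal 1"
    by (intro nn_integral_has_integral_lebesgue' f0)
  moreover have "(\<integral>\<^sup>+x. ennreal (f x) * indicator {0<..<1} x \<partial>lborel) =
      (\<integral>\<^sup>+x. ennreal (f x) * indicator {0..1} x \<partial>lborel)"
    by (rule nn_integral_cong_AE, rule AE_mp[OF AE_lborel_singleton[of 0]],
        rule AE_mp[OF AE_lborel_singleton[of 1]], rule AE_I2) (auto simp: indicator_def)
  moreover have "(\<lambda>x. ennreal (f x) * indicator {0<..<1} x) \<in> borel_measurable lborel"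
    unfolding f_def by measurable
  moreover have "beta_law a b = density lborel (\<lambda>x. ennreal (f x) * indicator {0<..<1} x)"
    using False by (simp only: beta_law_def f_def c_def if_False)
  ultimately show ?thesis
    using prob_space_density_lborel by simp
qed

lemma sets_kendall_point [simp]: "sets (kendall_point x y) = sets borel"
  and space_kendall_point [simp]: "space (kendall_point x y) = UNIV"
  by (simp_all add: kendall_point_def Let_def)

lemma kendall_point_commute: "kendall_point x y = kendall_point y x"
  by (simp add: kendall_point_def min.commute max.commute)

lemma kendall_point_zero [simp]: "kendall_point 0 0 = return borel 0"
  by (simp add: kendall_point_def)

lemma emeasure_kendall_point:
  assumes "0 \<le> a" "a \<le> b" "0 < b" "A \<in> sets borel"
  shows "emeasure (kendall_point a b) A =
    ennreal (1 - a / b) * emeasure (return borel b) A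
    + ennreal (a / b) * emeasure (scale_law b pareto2) A"
  using assms by (simp add: kendall_point_def emeasure_mix_law scale_law_def)

lemma prob_space_kendall_point: "prob_space (kendall_point x y)"
proof (cases "0 \<le> min x y \<and> 0 < max x y")
  case True
  interpret S: prob_space "scale_law (max x y) pareto2"
    unfolding scale_law_def by (intro prob_space.prob_space_distr prob_space_pareto2) simp
  define a b where ab: "a = min x y" "b = max x y"
  then have pos: "0 \<le> a" "a \<le> b" "0 < b" using True by simp_all
  have "kendall_point x y = mix_law (a / b) (return borel b) (scale_law b pareto2)"
    using pos by (simp only: kendall_point_def Let_def ab[symmetric] simp_thms if_True)
  moreover have "ennreal (1 - a / b) + ennreal (a / b) = 1"
    using pos by (subst ennreal_plus[symmetric]) simp_all
  moreover have "emeasure (scale_law b pareto2) UNIV = 1"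
    using S.emeasure_space_1 by (simp add: scale_law_def ab)
  ultimately show ?thesis
    by (intro prob_spaceI) (simp add: emeasure_mix_law scale_law_def)
next
  case False
  then have "kendall_point x y = return borel 0"
    by (simp only: kendall_point_def Let_def if_False)
  then show ?thesis by (simp add: prob_space_return)
qed

lemma measurable_kendall_point:
  "case_prod kendall_point \<in> borel \<Otimes>\<^sub>M borel \<rightarrow>\<^sub>M prob_algebra borel"
proof (intro measurable_prob_algebraI measurable_subprob_algebra)
  fix A :: "real set" assume A [measurable]: "A \<in> sets borel"
  interpret P: prob_space pareto2 by (rule prob_space_pareto2)
  have S: "emeasure (distr pareto2 borel ((*) b)) A = (\<integral>\<^sup>+t. indicator A (b * t) \<partial>pareto2)" for b
  proof -
    have "(\<integral>\<^sup>+t. indicator A (b * t) \<partial>pareto2) = (\<integral>\<^sup>+u. indicator A u \<partial>distr pareto2 borel ((*) b))"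
      by (rule nn_integral_distr[symmetric]) simp_all
    then show ?thesis by simp
  qed
  define I where "I b = (\<integral>\<^sup>+t. indicator A (b * t) \<partial>pareto2)" for b :: real
  have [measurable]: "I \<in> borel_measurable borel"
    unfolding I_def
  proof (rule P.borel_measurable_nn_integral)
    show "(\<lambda>(b, t). indicator A (b * t) :: ennreal) \<in> borel_measurable (borel \<Otimes>\<^sub>M pareto2)"
      by measurable
  qed
  have "emeasure (kendall_point x y) A =
      (if 0 \<le> min x y \<and> 0 < max x y
       then ennreal (1 - min x y / max x y) * indicator A (max x y)
         + ennreal (min x y / max x y) * I (max x y)
       else indicator A 0)" for x y
    by (simp add: kendall_point_def Let_def emeasure_mix_law scale_law_def S I_def)
  then have "(\<lambda>z. emeasure (case z of (x, y) \<Rightarrow> kendall_point x y) A) =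
      (\<lambda>(x, y). if 0 \<le> min x y \<and> 0 < max x y
       then ennreal (1 - min x y / max x y) * indicator A (max x y)
         + ennreal (min x y / max x y) * I (max x y)
       else indicator A 0)"
    by (simp only: fun_eq_iff split_paired_All prod.case) blast
  moreover have "\<dots> \<in> borel_measurable (borel \<Otimes>\<^sub>M borel)"
    by measurable
  ultimately show "(\<lambda>z. emeasure (case z of (x, y) \<Rightarrow> kendall_point x y) A)
      \<in> borel_measurable (borel \<Otimes>\<^sub>M borel)"
    by (simp only:)
next
  fix z :: "real \<times> real"
  show "prob_space (case z of (x, y) \<Rightarrow> kendall_point x y)"
    by (cases z) (simp only: prod.case prob_space_kendall_point)
  then show "subprob_space (case z of (x, y) \<Rightarrow> kendall_point x y)"
    by (rule prob_space_imp_subprob_space)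
  show "sets (case z of (x, y) \<Rightarrow> kendall_point x y) = sets borel"
    by (cases z) (simp only: prod.case sets_kendall_point)
qed

lemma
  assumes "\<mu> \<in> space (prob_algebra borel)" "\<nu> \<in> space (prob_algebra borel)"
  shows kendall_conv_prob: "kendall_conv \<mu> \<nu> \<in> space (prob_algebra borel)"
    and emeasure_kendall_conv: "A \<in> sets borel \<Longrightarrow> emeasure (kendall_conv \<mu> \<nu>) A =
      (\<integral>\<^sup>+x. \<integral>\<^sup>+y. emeasure (kendall_point x y) A \<partial>\<nu> \<partial>\<mu>)"
proof -
  have K: "(\<lambda>x. \<nu> \<bind> kendall_point x) \<in> borel \<rightarrow>\<^sub>M prob_algebra borel"
    by (rule measurable_bind_prob_space2[OF measurable_const[OF assms(2)] measurable_kendall_point])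
  have k: "kendall_point x \<in> borel \<rightarrow>\<^sub>M prob_algebra borel" for x
    using measurable_Pair2[OF measurable_kendall_point, of x] by simp
  show "kendall_conv \<mu> \<nu> \<in> space (prob_algebra borel)"
    unfolding kendall_conv_def
    using measurable_space[OF measurable_bind_prob_space[OF measurable_const[OF assms(1)] K],
        of undefined "borel :: real measure"] by simp
  show "emeasure (kendall_conv \<mu> \<nu>) A =
      (\<integral>\<^sup>+x. \<integral>\<^sup>+y. emeasure (kendall_point x y) A \<partial>\<nu> \<partial>\<mu>)" if "A \<in> sets borel"
    unfolding kendall_conv_def emeasure_bind_prob_algebra[OF assms(1) K that]
      emeasure_bind_prob_algebra[OF assms(2) k that] ..
qed

lemma kendall_conv_return [simp]:
  "kendall_conv (return borel x) (return borel y) = kendall_point x y"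
proof (rule measure_eqI)
  have r: "return borel z \<in> space (prob_algebra borel)" for z :: real
    by (simp add: space_prob_algebra prob_space_return)
  show s: "sets (kendall_conv (return borel x) (return borel y)) = sets (kendall_point x y)"
    using kendall_conv_prob[OF r r, of x y] by (simp add: space_prob_algebra)
  fix A assume "A \<in> sets (kendall_conv (return borel x) (return borel y))"
  then have A [measurable]: "A \<in> sets borel" using s by simp
  have m: "(\<lambda>(x, y). emeasure (kendall_point x y) A) \<in> borel_measurable (borel \<Otimes>\<^sub>M borel)"
    using measurable_compose[OF measurable_prob_algebraD[OF measurable_kendall_point]
        measurable_emeasure_subprob_algebra[OF A]] by (simp add: split_beta')
  have "(\<lambda>v. emeasure (kendall_point u v) A) \<in> borel_measurable borel" for u
    using measurable_Pair2[OF m, of u] by simp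
  moreover have "(\<lambda>u. emeasure (kendall_point u y) A) \<in> borel_measurable borel"
    using measurable_Pair1[OF m, of y] by simp
  ultimately show "emeasure (kendall_conv (return borel x) (return borel y)) A =
      emeasure (kendall_point x y) A"
    by (simp add: emeasure_kendall_conv[OF r r A] nn_integral_return)
qed

end

theory Submission
  imports Defs
begin

text \<open>
  Everything becomes transparent in terms of the reciprocal \<open>U\<^sub>k = 1 / X\<^sub>k\<close>. From a state
  \<open>x \<ge> 1\<close> one step of the walk stays at \<open>x\<close> with probability \<open>1 - 1 / x\<close> and otherwise moves to \<open>x \<theta>\<close>
  with \<open>\<theta>\<close> Pareto distributed, so that \<open>P(X\<^sub>k\<^sub>+\<^sub>1 < c | X\<^sub>k = x) = 1 - x / c\<^sup>2\<close> for \<open>c > x\<close>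
  (\<open>emeasure_kendall_point_1_lessThan\<close>). Averaging this over a Beta law shows that one step maps the
  law \<open>\<beta>\<close> with parameters \<open>2, b\<close> of the reciprocal to the one with parameters \<open>2, b + 1\<close>
  (\<open>beta_law_2_tail_recursion\<close>). As \<open>X\<^sub>1 = 1\<close> almost surely, \<open>U\<^sub>k\<close> has the Beta law with parameters
  \<open>2, k - 1\<close> (\<open>kendall_walk_reciprocal_law\<close>).

  With \<open>c = x + w\<close> and \<open>u = 1 / x\<close> the one-step formula reads \<open>1 - u / (1 + w u)\<^sup>2\<close>, and hence
  \<open>P(X\<^sub>k\<^sub>+\<^sub>1 - X\<^sub>k < w) = 1 - E(U\<^sub>k / (1 + w U\<^sub>k)\<^sup>2)\<close>. The factor \<open>U\<^sub>k\<close> is absorbed by a change of measure: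
  weighting a Beta law by its variable raises the first parameter by one
  (\<open>beta_law_size_bias\<close>), and the normalising constant is the mean \<open>2 / (k + 1)\<close> of \<open>U\<^sub>k\<close>.

  The increments are not stationary because this probability differs for \<open>k = 1\<close> and \<open>k = 2\<close> when
  \<open>w\<close> is small: as \<open>w\<close> tends to \<open>0\<close>, it tends to \<open>1 - 2 / (k + 1)\<close>, the probability of not moving.
\<close>

section \<open>Joint laws from conditional kernels\<close>

text \<open>
  The Markov property prescribes the conditional law of \<open>Y\<close> only for sets that do not depend on \<open>X\<close>,
  whereas an increment compares \<open>Y\<close> with \<open>X\<close>. If \<open>Y\<close> has the conditional law \<open>K (X \<omega>)\<close> given a
  \<open>\<sigma>\<close>-algebra for which \<open>X\<close> is measurable, then \<open>X\<close> can be frozen inside \<open>K\<close>: both sides below are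
  finite measures in \<open>C\<close>, and on rectangles, which are stable under intersection and generate
  the product \<open>\<sigma>\<close>-algebra, they agree by the defining property of conditional expectation.
\<close>

lemma emeasure_pair_conditional_kernel:
  assumes M: "prob_space M" and F: "subalgebra M F"
    and X: "X \<in> F \<rightarrow>\<^sub>M S" and Y: "Y \<in> M \<rightarrow>\<^sub>M T" and K: "K \<in> S \<rightarrow>\<^sub>M prob_algebra T"
    and cond: "\<And>A. A \<in> sets T \<Longrightarrow>
      AE \<omega> in M. real_cond_exp M F (indicator (Y -` A \<inter> space M)) \<omega> = measure (K (X \<omega>)) A"
    and C: "C \<in> sets (S \<Otimes>\<^sub>M T)"
  shows "emeasure M {\<omega> \<in> space M. (X \<omega>, Y \<omega>) \<in> C} =
      (\<integral>\<^sup>+\<omega>. emeasure (K (X \<omega>)) (Pair (X \<omega>) -` C) \<partial>M)"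
proof -
  interpret prob_space M by (rule M)
  interpret finite_measure_subalgebra M F by unfold_locales (rule F)
  have XM [measurable]: "X \<in> M \<rightarrow>\<^sub>M S" by (rule measurable_from_subalg[OF F X])
  note Y [measurable]
  have Ks [measurable]: "K \<in> S \<rightarrow>\<^sub>M subprob_algebra T" by (rule measurable_prob_algebraD[OF K])
  have KX: "prob_space (K (X \<omega>))" "sets (K (X \<omega>)) = sets T" "X \<omega> \<in> space S"
    if "\<omega> \<in> space M" for \<omega>
    using measurable_space[OF XM that] measurable_space[OF K, of "X \<omega>"]
    by (auto simp: space_prob_algebra)
  \<comment> \<open>\<open>J \<omega>\<close> is the conditional law of the pair: the first coordinate frozen, the second drawn from \<open>K\<close>.\<close>
  define J where "J \<omega> = distr (K (X \<omega>)) (S \<Otimes>\<^sub>M T) (Pair (X \<omega>))" for \<omega>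
  have J: "J \<in> M \<rightarrow>\<^sub>M subprob_algebra (S \<Otimes>\<^sub>M T)"
    unfolding J_def by (rule measurable_distr2[where M=T]) measurable
  have emJ: "emeasure (J \<omega>) D = emeasure (K (X \<omega>)) (Pair (X \<omega>) -` D)"
    if "\<omega> \<in> space M" "D \<in> sets (S \<Otimes>\<^sub>M T)" for \<omega> D
  proof -
    have "Pair (X \<omega>) -` D \<subseteq> space T"
      using sets.sets_into_space[OF that(2)] by (auto simp: space_pair_measure)
    moreover have "Pair (X \<omega>) \<in> K (X \<omega>) \<rightarrow>\<^sub>M S \<Otimes>\<^sub>M T"
      using KX[OF that(1)] by (simp cong: measurable_cong_sets)
    ultimately show ?thesis
      using that KX(2)[OF that(1)] sets_eq_imp_space_eq[OF KX(2)[OF that(1)]]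
      by (simp add: J_def emeasure_distr Int_absorb2)
  qed
  have ne: "space M \<noteq> {}" by (rule not_empty)
  have eq: "distr M (S \<Otimes>\<^sub>M T) (\<lambda>\<omega>. (X \<omega>, Y \<omega>)) = M \<bind> J"
  proof (rule measure_eqI_generator_eq[OF Int_stable_pair_measure_generator[of S T],
        where \<Omega> = "space S \<times> space T" and A = "\<lambda>_. space S \<times> space T"])
    show "{a \<times> b | a b. a \<in> sets S \<and> b \<in> sets T} \<subseteq> Pow (space S \<times> space T)"
      by (rule pair_measure_closed)
    show "sets (distr M (S \<Otimes>\<^sub>M T) (\<lambda>\<omega>. (X \<omega>, Y \<omega>))) =
        sigma_sets (space S \<times> space T) {a \<times> b | a b. a \<in> sets S \<and> b \<in> sets T}"
      by (simp add: sets_pair_measure)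
    show "sets (M \<bind> J) = sigma_sets (space S \<times> space T) {a \<times> b | a b. a \<in> sets S \<and> b \<in> sets T}"
      using sets_bind[OF sets_kernel[OF J] ne] by (simp add: sets_pair_measure)
    show "range (\<lambda>_::nat. space S \<times> space T) \<subseteq> {a \<times> b | a b. a \<in> sets S \<and> b \<in> sets T}"
      by auto
    show "(\<Union>_::nat. space S \<times> space T) = space S \<times> space T" by simp
    show "emeasure (distr M (S \<Otimes>\<^sub>M T) (\<lambda>\<omega>. (X \<omega>, Y \<omega>))) (space S \<times> space T) \<noteq> \<infinity>"
      by (simp add: emeasure_distr)
    fix R assume "R \<in> {a \<times> b | a b. a \<in> sets S \<and> b \<in> sets T}"
    then obtain B A where R: "R = B \<times> A" and B [measurable]: "B \<in> sets S"
      and A [measurable]: "A \<in> sets T" by auto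
    have BF: "X -` B \<inter> space M \<in> sets F"
      using measurable_sets[OF X B] F by (simp add: subalgebra_def)
    have "emeasure (distr M (S \<Otimes>\<^sub>M T) (\<lambda>\<omega>. (X \<omega>, Y \<omega>))) R =
        emeasure M ((X -` B \<inter> space M) \<inter> (Y -` A \<inter> space M))"
      unfolding R by (subst emeasure_distr) (auto intro!: arg_cong[where f = "emeasure M"])
    also have "\<dots> = ennreal (measure M ((X -` B \<inter> space M) \<inter> (Y -` A \<inter> space M)))"
      by (rule emeasure_eq_measure)
    also have "measure M ((X -` B \<inter> space M) \<inter> (Y -` A \<inter> space M)) =
        (\<integral>\<omega>\<in>X -` B \<inter> space M. indicator (Y -` A \<inter> space M) \<omega> \<partial>M)"
      unfolding set_lebesgue_integral_def
      by (simp add: indicator_inter_arith[symmetric])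
    also have "\<dots> = (\<integral>\<omega>\<in>X -` B \<inter> space M.
        real_cond_exp M F (indicator (Y -` A \<inter> space M)) \<omega> \<partial>M)"
      by (rule real_cond_exp_intA[OF _ BF], rule integrable_real_indicator)
         (simp_all add: emeasure_eq_measure)
    also have "\<dots> = (\<integral>\<omega>. indicator B (X \<omega>) * measure (K (X \<omega>)) A \<partial>M)"
      unfolding set_lebesgue_integral_def
    proof (rule integral_cong_AE)
      show "AE \<omega> in M. indicator (X -` B \<inter> space M) \<omega> *\<^sub>R
          real_cond_exp M F (indicator (Y -` A \<inter> space M)) \<omega> =
          indicator B (X \<omega>) * measure (K (X \<omega>)) A"
        using cond[OF A] AE_space by eventually_elim (auto simp: indicator_def)
    qed measurable
    also have "ennreal \<dots> = (\<integral>\<^sup>+\<omega>. ennreal (indicator B (X \<omega>) * measure (K (X \<omega>)) A) \<partial>M)"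
      by (rule nn_integral_eq_integral[symmetric], rule integrable_const_bound[where B = 1])
         (auto intro!: mult_le_one prob_space.prob_le_1 KX simp: indicator_def)
    also have "\<dots> = (\<integral>\<^sup>+\<omega>. emeasure (J \<omega>) R \<partial>M)"
    proof (rule nn_integral_cong)
      fix \<omega> assume w: "\<omega> \<in> space M"
      interpret K: prob_space "K (X \<omega>)" by (rule KX[OF w])
      show "ennreal (indicator B (X \<omega>) * measure (K (X \<omega>)) A) = emeasure (J \<omega>) R"
        unfolding R by (subst emJ[OF w]) (auto simp: indicator_def K.emeasure_eq_measure)
    qed
    also have "\<dots> = emeasure (M \<bind> J) R"
      unfolding R by (rule emeasure_bind[symmetric, OF ne J]) measurable
    finally show "emeasure (distr M (S \<Otimes>\<^sub>M T) (\<lambda>\<omega>. (X \<omega>, Y \<omega>))) R = emeasure (M \<bind> J) R" .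
  qed
  have "emeasure M {\<omega> \<in> space M. (X \<omega>, Y \<omega>) \<in> C} =
      emeasure (distr M (S \<Otimes>\<^sub>M T) (\<lambda>\<omega>. (X \<omega>, Y \<omega>))) C"
    using C by (subst emeasure_distr) (auto intro!: arg_cong[where f = "emeasure M"])
  also have "\<dots> = (\<integral>\<^sup>+\<omega>. emeasure (J \<omega>) C \<partial>M)"
    unfolding eq by (rule emeasure_bind[OF ne J C])
  also have "\<dots> = (\<integral>\<^sup>+\<omega>. emeasure (K (X \<omega>)) (Pair (X \<omega>) -` C) \<partial>M)"
    by (rule nn_integral_cong) (rule emJ[OF _ C])
  finally show ?thesis .
qed

section \<open>One step of the Kendall walk from a point\<close>

lemma emeasure_pareto2_lessThan:
  assumes "1 \<le> c"
  shows "emeasure pareto2 {..<c} = ennreal (1 - 1 / c\<^sup>2)"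
proof -
  interpret prob_space pareto2 by (rule prob_space_pareto2)
  have "emeasure pareto2 {c..} =
      (\<integral>\<^sup>+x. ennreal (2 * x powr (-3)) * indicator {1<..} x * indicator {c..} x \<partial>lborel)"
    unfolding pareto2_def by (rule emeasure_density) measurable
  also have "\<dots> = (\<integral>\<^sup>+x. ennreal (2 * (x::real) powr (-3)) * indicator {c..} x \<partial>lborel)"
    by (rule nn_integral_cong_AE, rule AE_mp[OF AE_lborel_singleton[of 1]], rule AE_I2)
       (use assms in \<open>auto simp: indicator_def\<close>)
  also have "\<dots> = ennreal (0 - (- (c powr (-2))))"
  proof (rule nn_integral_FTC_atLeast)
    show "((\<lambda>x::real. - (x powr (-2))) has_real_derivative 2 * x powr (-3)) (at x)" if "c \<le> x" for x
      using that assms by (auto intro!: derivative_eq_intros)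
    show "((\<lambda>x::real. - (x powr (-2))) \<longlongrightarrow> 0) at_top"
      by (rule tendsto_eq_rhs[OF tendsto_minus[OF tendsto_neg_powr[OF _ filterlim_ident]]]) simp_all
  qed simp_all
  also have "0 - (- (c powr (-2))) = 1 / c\<^sup>2"
    using assms by (simp add: powr_minus_divide)
  finally have "prob {c..} = 1 / c\<^sup>2"
    by (simp add: emeasure_eq_measure)
  moreover have "{..<c} = space pareto2 - {c..}" by auto
  ultimately have "prob {..<c} = 1 - 1 / c\<^sup>2"
    using prob_compl[of "{c..}"] by simp
  then show ?thesis by (simp add: emeasure_eq_measure)
qed

text \<open>
  For \<open>c > x\<close> the atom at \<open>x\<close> contributes \<open>1 - 1 / x\<close> and the scaled Pareto part
  \<open>(1 / x) (1 - (x / c)\<^sup>2)\<close>; the terms \<open>1 / x\<close> cancel.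
\<close>

lemma emeasure_kendall_point_1_lessThan:
  assumes x: "1 \<le> x"
  shows "emeasure (kendall_point x 1) {..<c} = (if c \<le> x then 0 else ennreal (1 - x / c\<^sup>2))"
proof -
  have "emeasure (scale_law x pareto2) {..<c} = emeasure pareto2 {..<c / x}"
    unfolding scale_law_def using x
    by (subst emeasure_distr) (auto intro!: arg_cong[where f = "emeasure pareto2"] simp: field_simps)
  then have K: "emeasure (kendall_point x 1) {..<c} =
      ennreal (1 - 1 / x) * indicator {..<c} x + ennreal (1 / x) * emeasure pareto2 {..<c / x}"
    using x emeasure_kendall_point[of 1 x "{..<c}"] by (simp add: kendall_point_commute[of x])
  show ?thesis
  proof (cases "c \<le> x")
    case True
    have "emeasure pareto2 {..<c / x} \<le> emeasure pareto2 {..<1}"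
      by (rule emeasure_mono) (use True x in \<open>auto simp: field_simps\<close>)
    also have "\<dots> = 0" by (simp add: emeasure_pareto2_lessThan)
    finally show ?thesis using True by (simp add: K)
  next
    case False
    then have cx: "1 \<le> c / x" "0 < c" using x by (auto simp: field_simps)
    have "0 \<le> 1 - 1 / (c / x)\<^sup>2"
      using one_le_power[OF cx(1), of 2] by (auto simp: divide_le_eq_1 simp del: power_divide)
    moreover have "0 \<le> 1 - 1 / x" "0 \<le> 1 / x" using x by simp_all
    ultimately have "emeasure (kendall_point x 1) {..<c} =
        ennreal ((1 - 1 / x) + (1 / x) * (1 - 1 / (c / x)\<^sup>2))"
      using False unfolding K emeasure_pareto2_lessThan[OF cx(1)]
      by (subst ennreal_plus, simp, simp, subst ennreal_mult) simp_all
    also have "(1 - 1 / x) + (1 / x) * (1 - 1 / (c / x)\<^sup>2) = 1 - x / c\<^sup>2"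
      using x cx by (simp add: field_simps power2_eq_square)
    finally show ?thesis using False by simp
  qed
qed

lemma kendall_point_0_1: "kendall_point 0 1 = return borel 1"
  by (rule measure_eqI) (simp_all add: emeasure_kendall_point)

section \<open>Beta laws\<close>

lemma sets_beta_law [simp, measurable_cong]: "sets (beta_law a b) = sets borel"
  and space_beta_law [simp]: "space (beta_law a b) = UNIV"
  by (simp_all add: beta_law_def)

lemma AE_beta_law: "AE x in beta_law a b. 0 < x \<and> x \<le> 1"
proof (cases "b = 0")
  case True
  have "AE x in return borel (1::real). 0 < x \<and> x \<le> 1"
    by (subst AE_return) simp_all
  moreover have "beta_law a b = return borel 1" using True by (simp add: beta_law_def)
  ultimately show ?thesis by (simp only:)
next
  case False
  then show ?thesis
    unfolding beta_law_def if_not_P[OF False]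
    by (subst AE_density) (auto simp: indicator_def)
qed

text \<open>
  Size-biasing a Beta law, by its mean \<open>a / (a + b)\<close>, raises the first parameter: the density gains a
  factor \<open>x\<close>, and \<open>\<Gamma>(z + 1) = z \<Gamma>(z)\<close> matches the constants. At \<open>b = 0\<close> both sides are the
  point mass at \<open>1\<close>.
\<close>

lemma beta_law_size_bias:
  assumes a: "0 < a" and b: "0 \<le> b"
  shows "beta_law (a + 1) b = density (beta_law a b) (\<lambda>x. ennreal ((a + b) / a * x))"
proof (cases "b = 0")
  case True
  with a show ?thesis
    by (intro measure_eqI) (simp_all add: beta_law_def emeasure_density nn_integral_return)
next
  case False
  with b have b: "0 < b" by simp
  define c where "c = Gamma (a + b) / (Gamma a * Gamma b)"
  have c: "0 \<le> c" using a b by (simp add: c_def Gamma_real_nonneg)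
  have "Gamma (a + 1 + b) = (a + b) * Gamma (a + b)"
    using a b Gamma_plus1[of "a + b"] by (simp add: add_ac nonpos_Ints_def)
  moreover have "Gamma (a + 1) = a * Gamma a"
    using a Gamma_plus1[of a] by (auto simp: nonpos_Ints_def)
  ultimately have G: "Gamma (a + 1 + b) / (Gamma (a + 1) * Gamma b) = (a + b) / a * c"
    by (simp add: c_def)
  have "ennreal ((a + b) / a * c * x powr (a + 1 - 1) * (1 - x) powr (b - 1)) * indicator {0<..<1} x =
      ennreal (c * x powr (a - 1) * (1 - x) powr (b - 1)) * indicator {0<..<1} x *
      ennreal ((a + b) / a * x)" for x
  proof (cases "0 < x \<and> x < 1")
    case True
    then have "x powr (a + 1 - 1) = x powr (a - 1) * x"
      using powr_add[of x "a - 1" 1] by simp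
    with True a b c show ?thesis
      by (simp add: ennreal_mult'[symmetric] mult_ac)
  qed auto
  with b show ?thesis
    unfolding beta_law_def by (simp add: G c_def[symmetric] density_density_eq)
qed

text \<open>
  The density with parameters \<open>2, b\<close> is \<open>b (b + 1) x (1 - x)\<^sup>b\<^sup>-\<^sup>1\<close>, so the integrand times
  the density is linear in \<open>x\<close> times \<open>(1 - x)\<^sup>b\<^sup>-\<^sup>1\<close>, with an elementary antiderivative.
  The parameter \<open>q\<close> serves two purposes: \<open>q = 0\<close> gives the tail of the Beta law itself, and
  \<open>q = s\<^sup>2\<close> the tail after one step of the walk.
\<close>

lemma beta_law_2_truncated_moment:
  assumes b: "0 \<le> b" and q: "0 \<le> q" "q \<le> s" and s: "s < 1"
  shows "(\<integral>\<^sup>+x. ennreal (1 - q / x) * indicator {s<..} x \<partial>beta_law 2 b) =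
      ennreal ((1 - s) powr b * (1 + b * s - (b + 1) * q))"
proof (cases "b = 0")
  case True
  with assms show ?thesis by (simp add: beta_law_def nn_integral_return)
next
  case False
  with b have b: "0 < b" by simp
  define f where "f x = (b + 1) * b * (x - q) * (1 - x) powr (b - 1)" for x
  define H where "H x = - ((1 - x) powr b * (1 + b * x - (b + 1) * q))" for x
  have G: "Gamma (2 + b) / (Gamma 2 * Gamma b) = (b + 1) * b"
  proof -
    have "Gamma (2 + b) = (b + 1) * (b * Gamma b)"
      using b Gamma_plus1[of "b + 1"] Gamma_plus1[of b] by (auto simp: add_ac nonpos_Ints_def)
    moreover have "Gamma (2::real) = 1" using Gamma_fact[of 1, where ?'a = real] by simp
    moreover have "Gamma b \<noteq> 0" using Gamma_real_pos[OF b] by simp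
    ultimately show ?thesis by simp
  qed
  \<comment> \<open>For \<open>b < 1\<close> the integrand is unbounded at \<open>1\<close>, but its antiderivative is still continuous there.\<close>
  have "(f has_integral (H 1 - H s)) {s..1}"
  proof (rule fundamental_theorem_of_calculus_interior)
    show "continuous_on {s..1} H"
      unfolding H_def using b by (intro continuous_intros continuous_on_powr') auto
    fix x assume x: "x \<in> {s<..<1}"
    have p: "(1 - x) powr b = (1 - x) * (1 - x) powr (b - 1)"
      using x powr_add[of "1 - x" 1 "b - 1"] by simp
    have "(H has_real_derivative f x) (at x)"
      unfolding H_def f_def using x b
      by (auto intro!: derivative_eq_intros simp: p) (simp add: algebra_simps)
    then show "(H has_vector_derivative f x) (at x)"
      by (simp add: has_real_derivative_iff_has_vector_derivative)
  qed (use s in simp)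
  then have "(\<integral>\<^sup>+x. ennreal (f x) * indicator {s..1} x \<partial>lborel) = ennreal (H 1 - H s)"
    using b q by (intro nn_integral_has_integral_lebesgue'[rotated]) (assumption, simp add: f_def)
  moreover have "(\<integral>\<^sup>+x. ennreal (1 - q / x) * indicator {s<..} x \<partial>beta_law 2 b) =
      (\<integral>\<^sup>+x. ennreal (f x) * indicator {s..1} x \<partial>lborel)"
  proof -
    have "ennreal ((b + 1) * b * x powr (2 - 1) * (1 - x) powr (b - 1)) * indicator {0<..<1} x *
        (ennreal (1 - q / x) * indicator {s<..} x) = ennreal (f x) * indicator {s..1} x"
      if "x \<noteq> s" "x \<noteq> 1" for x
    proof (cases "s < x \<and> x < 1")
      case True
      then have "f x = ((b + 1) * b * x powr (2 - 1) * (1 - x) powr (b - 1)) * (1 - q / x)"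
        using q by (simp add: f_def field_simps)
      with True b q show ?thesis
        by (simp add: ennreal_mult'[symmetric] del: powr_one)
    qed (use that in auto)
    then show ?thesis
      unfolding beta_law_def G using b
      apply (subst if_not_P, simp)
      apply (subst nn_integral_density)
        apply measurable
      apply (rule nn_integral_cong_AE, rule AE_mp[OF AE_lborel_singleton[of s]],
        rule AE_mp[OF AE_lborel_singleton[of 1]], rule AE_I2)
      apply blast
      done
  qed
  ultimately show ?thesis by (simp add: H_def)
qed

section \<open>The law of the walk\<close>

text \<open>
  One step of the walk is governed by the kernel \<open>\<delta>\<^sub>x \<triangle>\<^sub>1 \<delta>\<^sub>1\<close>, since the first convolution power of
  \<open>\<delta>\<^sub>1\<close> is \<open>\<delta>\<^sub>1\<close> itself. The law of \<open>X\<^sub>k\<close> is built up from these single steps, which avoids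
  computing the higher convolution powers.
\<close>

lemma emeasure_kendall_walk_step:
  assumes walk: "kendall_random_walk M (return borel 1) X"
    and C: "C \<in> sets (borel \<Otimes>\<^sub>M borel)"
  shows "emeasure M {\<omega> \<in> space M. (X k \<omega>, X (Suc k) \<omega>) \<in> C} =
      (\<integral>\<^sup>+\<omega>. emeasure (kendall_point (X k \<omega>) 1) (Pair (X k \<omega>) -` C) \<partial>M)"
proof (rule emeasure_pair_conditional_kernel[OF _ _ _ _ _ _ C])
  have X: "X n \<in> borel_measurable M" for n
    using walk by (simp add: kendall_random_walk_def)
  show "prob_space M" using walk by (simp add: kendall_random_walk_def)
  define G where "G = {X i -` B \<inter> space M | i B. i \<le> k \<and> B \<in> sets borel}"
  have G: "G \<subseteq> sets M" "G \<subseteq> Pow (space M)"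
    using measurable_sets[OF X] by (auto simp: G_def)
  have past: "past M X k = sigma (space M) G" by (simp add: past_def G_def)
  show "subalgebra M (past M X k)"
    unfolding past subalgebra_def using G sets.sigma_sets_subset[of G M] by simp
  show "X k \<in> borel_measurable (past M X k)"
  proof (rule measurableI)
    fix B :: "real set" assume "B \<in> sets borel"
    then have "X k -` B \<inter> space M \<in> G" by (auto simp: G_def)
    then show "X k -` B \<inter> space (past M X k) \<in> sets (past M X k)"
      unfolding past using G by auto
  qed simp
  show "X (Suc k) \<in> borel_measurable M" by (rule X)
  show "(\<lambda>x. kendall_point x 1) \<in> borel \<rightarrow>\<^sub>M prob_algebra borel"
    using measurable_Pair1[OF measurable_kendall_point, of 1] by simp
  fix A :: "real set" assume A: "A \<in> sets borel"
  have "AE \<omega> in M. real_cond_exp M (past M X k) (indicator (X (Suc k) -` A \<inter> space M)) \<omega> =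
      measure (kendall_conv (return borel (X k \<omega>)) (kendall_power (return borel 1) (Suc k - k))) A"
    using walk A lessI unfolding kendall_random_walk_def by blast
  then show "AE \<omega> in M. real_cond_exp M (past M X k) (indicator (X (Suc k) -` A \<inter> space M)) \<omega> =
      measure (kendall_point (X k \<omega>) 1) A"
    by (simp add: kendall_point_0_1)
qed

lemma AE_ge_1_of_reciprocal_beta:
  assumes Z: "Z \<in> borel_measurable M" and law: "distr M borel (\<lambda>\<omega>. 1 / Z \<omega>) = beta_law a b"
  shows "AE \<omega> in M. 1 \<le> (Z \<omega> :: real)"
proof -
  have "AE u in distr M borel (\<lambda>\<omega>. 1 / Z \<omega>). 0 < u \<and> u \<le> 1"
    unfolding law by (rule AE_beta_law)
  then have "AE \<omega> in M. 0 < 1 / Z \<omega> \<and> 1 / Z \<omega> \<le> 1"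
    by (rule AE_distrD[rotated]) (use Z in measurable)
  then show ?thesis
    by eventually_elim (auto simp: field_simps)
qed

lemma nn_integral_of_reciprocal_law:
  assumes [measurable]: "Z \<in> borel_measurable M" "f \<in> borel_measurable borel"
  shows "(\<integral>\<^sup>+\<omega>. f (Z \<omega> :: real) \<partial>M) = (\<integral>\<^sup>+u. f (1 / u) \<partial>distr M borel (\<lambda>\<omega>. 1 / Z \<omega>))"
  by (subst nn_integral_distr) simp_all

text \<open>
  The left side is the probability that the walk is below \<open>1 / s\<close>, that is, its reciprocal above \<open>s\<close>,
  after a step from a state whose reciprocal has the Beta law with parameters \<open>2, b\<close>. The identity
  expresses that one step increases the second parameter by one; it amounts to the factorisation
  \<open>1 + b s - (b + 1) s\<^sup>2 = (1 - s) (1 + (b + 1) s)\<close>.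
\<close>

lemma beta_law_2_tail_recursion:
  assumes b: "0 \<le> b" and s: "0 < s" "s < 1"
  shows "(\<integral>\<^sup>+u. (if 1 / s \<le> 1 / u then 0 else ennreal (1 - (1 / u) / (1 / s)\<^sup>2)) \<partial>beta_law 2 b) =
      emeasure (beta_law 2 (b + 1)) {s<..}"
proof -
  have "(\<integral>\<^sup>+u. (if 1 / s \<le> 1 / u then 0 else ennreal (1 - (1 / u) / (1 / s)\<^sup>2)) \<partial>beta_law 2 b) =
      (\<integral>\<^sup>+u. ennreal (1 - s\<^sup>2 / u) * indicator {s<..} u \<partial>beta_law 2 b)"
    by (rule nn_integral_cong_AE, rule AE_mp[OF AE_beta_law], rule AE_I2)
       (use s in \<open>auto simp: indicator_def field_simps\<close>)
  also have "\<dots> = ennreal ((1 - s) powr b * (1 + b * s - (b + 1) * s\<^sup>2))"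
    using b s by (intro beta_law_2_truncated_moment) (auto simp: power2_eq_square mult_le_cancel_left1)
  also have "(1 - s) powr b * (1 + b * s - (b + 1) * s\<^sup>2) =
      (1 - s) powr (b + 1) * (1 + (b + 1) * s - (b + 1 + 1) * 0)"
    using s by (simp add: powr_add) (simp add: algebra_simps power2_eq_square)
  also have "ennreal \<dots> = (\<integral>\<^sup>+u. ennreal (1 - 0 / u) * indicator {s<..} u \<partial>beta_law 2 (b + 1))"
    using b s by (intro beta_law_2_truncated_moment[symmetric]) auto
  also have "\<dots> = emeasure (beta_law 2 (b + 1)) {s<..}" by simp
  finally show ?thesis .
qed

text \<open>
  The induction starts at time \<open>1\<close>, where the walk sits at \<open>1\<close> and the Beta law is degenerate. The
  induction step compares tails: only levels \<open>s\<close> strictly between \<open>0\<close> and \<open>1\<close> need the recursion, since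
  both laws are concentrated on \<open>(0, 1]\<close>.
\<close>

lemma kendall_walk_reciprocal_law:
  assumes walk: "kendall_random_walk M (return borel 1) X"
  shows "distr M borel (\<lambda>\<omega>. 1 / X (Suc k) \<omega>) = beta_law 2 (real k)"
proof (induction k)
  interpret prob_space M using walk by (simp add: kendall_random_walk_def)
  have X [measurable]: "X n \<in> borel_measurable M" for n
    using walk by (simp add: kendall_random_walk_def)
  case 0
  have X0: "AE \<omega> in M. X 0 \<omega> = 0" using walk by (simp add: kendall_random_walk_def)
  have "emeasure M {\<omega> \<in> space M. X 1 \<omega> \<noteq> 1} =
      (\<integral>\<^sup>+\<omega>. emeasure (kendall_point (X 0 \<omega>) 1) (- {1}) \<partial>M)"
    using emeasure_kendall_walk_step[OF walk, of "UNIV \<times> (- {1})" 0] by simp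
  also have "\<dots> = (\<integral>\<^sup>+\<omega>. 0 \<partial>M)"
    by (rule nn_integral_cong_AE, rule AE_mp[OF X0], rule AE_I2) (simp add: kendall_point_0_1)
  finally have "AE \<omega> in M. X 1 \<omega> = 1"
    by (intro AE_I[where N = "{\<omega> \<in> space M. X 1 \<omega> \<noteq> 1}"]) auto
  then have "distr M borel (\<lambda>\<omega>. 1 / X 1 \<omega>) = distr M borel (\<lambda>_. 1)"
    by (intro distr_cong_AE) auto
  then show ?case by (simp add: beta_law_def)
next
  interpret prob_space M using walk by (simp add: kendall_random_walk_def)
  have X [measurable]: "X n \<in> borel_measurable M" for n
    using walk by (simp add: kendall_random_walk_def)
  case (Suc k)
  let ?Z = "X (Suc (Suc k))"
  have Zlt: "emeasure M {\<omega> \<in> space M. ?Z \<omega> < c} =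
      (\<integral>\<^sup>+u. (if c \<le> 1 / u then 0 else ennreal (1 - (1 / u) / c\<^sup>2)) \<partial>beta_law 2 (real k))" for c
  proof -
    have "emeasure M {\<omega> \<in> space M. ?Z \<omega> < c} =
        (\<integral>\<^sup>+\<omega>. emeasure (kendall_point (X (Suc k) \<omega>) 1) {..<c} \<partial>M)"
      using emeasure_kendall_walk_step[OF walk, of "UNIV \<times> {..<c}" "Suc k"] by simp
    also have "\<dots> = (\<integral>\<^sup>+\<omega>. (if c \<le> X (Suc k) \<omega> then 0
        else ennreal (1 - X (Suc k) \<omega> / c\<^sup>2)) \<partial>M)"
      by (rule nn_integral_cong_AE, rule AE_mp[OF AE_ge_1_of_reciprocal_beta[OF X Suc]], rule AE_I2)
         (simp add: emeasure_kendall_point_1_lessThan)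
    also have "\<dots> = (\<integral>\<^sup>+u. (if c \<le> 1 / u then 0 else ennreal (1 - (1 / u) / c\<^sup>2)) \<partial>beta_law 2 (real k))"
      using nn_integral_of_reciprocal_law[OF X[of "Suc k"],
          of "\<lambda>x. if c \<le> x then 0 else ennreal (1 - x / c\<^sup>2)"]
      unfolding Suc by simp
    finally show ?thesis .
  qed
  \<comment> \<open>At \<open>c = 1\<close> the one-step formula says that the walk never falls below \<open>1\<close>.\<close>
  have "emeasure M {\<omega> \<in> space M. ?Z \<omega> < 1} = (\<integral>\<^sup>+u. 0 \<partial>beta_law 2 (real k))"
    unfolding Zlt by (rule nn_integral_cong_AE, rule AE_mp[OF AE_beta_law], rule AE_I2)
      (auto simp: field_simps)
  then have Z1: "AE \<omega> in M. 1 \<le> ?Z \<omega>"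
    by (intro AE_I[where N = "{\<omega> \<in> space M. ?Z \<omega> < 1}"]) auto
  interpret B: prob_space "beta_law 2 (real (Suc k))" by (rule prob_space_beta_law) simp_all
  have "emeasure (distr M borel (\<lambda>\<omega>. 1 / ?Z \<omega>)) {s<..} =
      emeasure (beta_law 2 (real (Suc k))) {s<..}" for s
  proof -
    have D: "emeasure (distr M borel (\<lambda>\<omega>. 1 / ?Z \<omega>)) {s<..} =
        emeasure M {\<omega> \<in> space M. s < 1 / ?Z \<omega>}"
      by (subst emeasure_distr) (auto intro!: arg_cong[where f = "emeasure M"])
    consider "s \<le> 0" | "0 < s" "s < 1" | "1 \<le> s" by linarith
    then show ?thesis
    proof cases
      case 1
      have "AE \<omega> in M. s < 1 / ?Z \<omega>"
        using Z1 by eventually_elim (use 1 in \<open>auto intro: le_less_trans\<close>)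
      moreover have "AE u in beta_law 2 (real (Suc k)). u \<in> {s<..}"
        using AE_beta_law by eventually_elim (use 1 in auto)
      ultimately show ?thesis
        unfolding D by (simp add: emeasure_eq_1_AE B.emeasure_eq_1_AE del: of_nat_Suc)
    next
      case 2
      have "emeasure M {\<omega> \<in> space M. s < 1 / ?Z \<omega>} = emeasure M {\<omega> \<in> space M. ?Z \<omega> < 1 / s}"
        by (rule emeasure_eq_AE, rule AE_mp[OF Z1], rule AE_I2)
           (use 2 in \<open>auto simp: field_simps\<close>)
      then show ?thesis
        unfolding D Zlt using beta_law_2_tail_recursion[OF _ 2, of "real k"] by (simp add: add_ac)
    next
      case 3
      have "AE \<omega> in M. \<not> s < 1 / ?Z \<omega>"
        using Z1 by eventually_elim (use 3 in \<open>auto simp: not_less intro: order_trans[of _ 1]\<close>)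
      then have "emeasure M {\<omega> \<in> space M. s < 1 / ?Z \<omega>} = 0"
        by (subst (asm) AE_iff_measurable[OF _ refl]) auto
      moreover have "AE u in beta_law 2 (real (Suc k)). u \<notin> {s<..}"
        using AE_beta_law by eventually_elim (use 3 in auto)
      then have "emeasure (beta_law 2 (real (Suc k))) {s<..} = 0"
        by (subst (asm) AE_iff_measurable[OF _ refl]) (auto simp: greaterThan_def)
      ultimately show ?thesis unfolding D by simp
    qed
  qed
  then show ?case
    by (intro measure_eqI_lessThan)
       (auto simp: emeasure_distr emeasure_eq_measure B.emeasure_eq_measure simp del: of_nat_Suc)
qed

section \<open>Increments\<close>

text \<open>
  Given \<open>X\<^sub>k = x\<close>, the event is \<open>X\<^sub>k\<^sub>+\<^sub>1 < x + w\<close>, of probability \<open>1 - x / (x + w)\<^sup>2\<close>. In the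
  variable \<open>u = 1 / x\<close> this is \<open>1 - g u\<close> for the function \<open>g\<close> below, and integrating \<open>g\<close> against the law of
  \<open>1 / X\<^sub>k\<close> is a size-biased expectation.
\<close>

lemma kendall_walk_increment_less:
  assumes walk: "kendall_random_walk M (return borel 1) X" and k: "1 \<le> k" and w: "0 < w"
  shows "measure M {\<omega> \<in> space M. X (k + 1) \<omega> - X k \<omega> < w} =
      1 - 2 / (real k + 1) * (\<integral>y. (1 + w * y) powi (-2) \<partial>beta_law 3 (real k - 1))"
proof -
  interpret prob_space M using walk by (simp add: kendall_random_walk_def)
  have X [measurable]: "X n \<in> borel_measurable M" for n
    using walk by (simp add: kendall_random_walk_def)
  define b where "b = real k - 1"
  have b: "0 \<le> b" using k by (simp add: b_def)
  interpret B: prob_space "beta_law 2 b" by (rule prob_space_beta_law) (simp_all add: b)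
  have law: "distr M borel (\<lambda>\<omega>. 1 / X k \<omega>) = beta_law 2 b"
    using kendall_walk_reciprocal_law[OF walk, of "k - 1"] k by (simp add: b_def of_nat_diff)
  define g where "g u = u * (1 + w * u) powi (-2)" for u
  have g_eq: "g u = u / (1 + w * u)\<^sup>2" for u
    by (simp add: g_def power_int_minus divide_inverse)
  have [measurable]: "g \<in> borel_measurable borel" unfolding g_eq[abs_def] by measurable
  have g: "0 \<le> g u" "g u \<le> 1" if "0 < u" "u \<le> 1" for u
  proof -
    show "0 \<le> g u" using that w by (simp add: g_eq)
    have "u \<le> 1\<^sup>2" using that by simp
    also have "1\<^sup>2 \<le> (1 + w * u)\<^sup>2" using that w by (intro power_mono) simp_all
    finally show "g u \<le> 1" using that w by (simp add: g_eq divide_le_eq_1)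
  qed
  have gint: "integrable (beta_law 2 b) g"
    by (rule B.integrable_const_bound[where B = 1], rule AE_mp[OF AE_beta_law], rule AE_I2)
       (auto simp: g)
  have "emeasure M {\<omega> \<in> space M. X (k + 1) \<omega> - X k \<omega> < w} =
      (\<integral>\<^sup>+\<omega>. emeasure (kendall_point (X k \<omega>) 1) {..<X k \<omega> + w} \<partial>M)"
  proof -
    have "{z \<in> space (borel \<Otimes>\<^sub>M borel). snd z - fst z < w} \<in> sets (borel \<Otimes>\<^sub>M borel)"
      by measurable
    then have "{(x, y). y - x < w} \<in> sets (borel \<Otimes>\<^sub>M borel)"
      by (simp add: space_pair_measure split_beta')
    moreover have "Pair x -` {(x, y). y - x < w} = {..<x + w}" for x by auto
    ultimately show ?thesis
      using emeasure_kendall_walk_step[OF walk, of "{(x, y). y - x < w}" k] by simp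
  qed
  also have "\<dots> = (\<integral>\<^sup>+\<omega>. ennreal (1 - X k \<omega> / (X k \<omega> + w)\<^sup>2) \<partial>M)"
    by (rule nn_integral_cong_AE, rule AE_mp[OF AE_ge_1_of_reciprocal_beta[OF X law]], rule AE_I2)
       (use w in \<open>simp add: emeasure_kendall_point_1_lessThan\<close>)
  also have "\<dots> = (\<integral>\<^sup>+u. ennreal (1 - (1 / u) / (1 / u + w)\<^sup>2) \<partial>beta_law 2 b)"
    unfolding law[symmetric] by (rule nn_integral_of_reciprocal_law) measurable
  also have "\<dots> = (\<integral>\<^sup>+u. ennreal (1 - g u) \<partial>beta_law 2 b)"
  proof (rule nn_integral_cong_AE, rule AE_mp[OF AE_beta_law], rule AE_I2, rule impI)
    fix u :: real assume u: "0 < u \<and> u \<le> 1"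
    have "(1 / u) / (1 / u + w)\<^sup>2 = (1 / u) / ((1 + w * u) / u)\<^sup>2"
      using u by (simp add: add_divide_distrib)
    also have "\<dots> = g u" using u by (simp add: g_eq power_divide power2_eq_square)
    finally show "ennreal (1 - (1 / u) / (1 / u + w)\<^sup>2) = ennreal (1 - g u)" by simp
  qed
  also have "\<dots> = ennreal (\<integral>u. 1 - g u \<partial>beta_law 2 b)"
    by (rule nn_integral_eq_integral, intro Bochner_Integration.integrable_diff gint,
        simp, rule AE_mp[OF AE_beta_law], rule AE_I2) (auto simp: g)
  finally have "ennreal (measure M {\<omega> \<in> space M. X (k + 1) \<omega> - X k \<omega> < w}) =
      ennreal (\<integral>u. 1 - g u \<partial>beta_law 2 b)" by (simp add: emeasure_eq_measure)
  moreover have "0 \<le> (\<integral>u. 1 - g u \<partial>beta_law 2 b)"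
    by (rule integral_nonneg_AE, rule AE_mp[OF AE_beta_law], rule AE_I2) (auto simp: g)
  ultimately have "measure M {\<omega> \<in> space M. X (k + 1) \<omega> - X k \<omega> < w} =
      (\<integral>u. 1 - g u \<partial>beta_law 2 b)" by simp
  also have "\<dots> = 1 - (\<integral>u. g u \<partial>beta_law 2 b)"
    using gint B.prob_space by (simp add: Bochner_Integration.integral_diff)
  also have "(\<integral>u. g u \<partial>beta_law 2 b) =
      2 / (2 + b) * (\<integral>y. (1 + w * y) powi (-2) \<partial>beta_law 3 b)"
  proof -
    have B3: "beta_law 3 b = density (beta_law 2 b) (\<lambda>y. ennreal ((2 + b) / 2 * y))"
      using beta_law_size_bias[OF _ b, of 2] by simp
    have "(\<integral>y. (1 + w * y) powi (-2) \<partial>beta_law 3 b) =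
        (\<integral>y. ((2 + b) / 2 * y) *\<^sub>R (1 + w * y) powi (-2) \<partial>beta_law 2 b)"
      unfolding B3
    proof (rule integral_density)
      show "AE y in beta_law 2 b. 0 \<le> (2 + b) / 2 * y"
        using AE_beta_law by eventually_elim (use b in simp)
    qed (simp_all add: power_int_minus)
    also have "\<dots> = (2 + b) / 2 * (\<integral>u. g u \<partial>beta_law 2 b)"
      by (simp add: g_def mult.assoc flip: Bochner_Integration.integral_mult_right_zero)
    finally show ?thesis using b by (simp add: field_simps)
  qed
  finally show ?thesis by (simp add: b_def)
qed

theorem proposition3p7:
  fixes M :: "'a measure" and X :: "nat \<Rightarrow> 'a \<Rightarrow> real"
  assumes "kendall_random_walk M (return borel 1) X"
  shows "(\<forall>k\<ge>1. \<forall>w>0. \<forall>(N :: 'b measure) Y.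
            prob_space N \<longrightarrow> Y \<in> borel_measurable N \<longrightarrow>
            distr N borel Y = beta_law 3 (real k - 1) \<longrightarrow>
            measure M {\<omega> \<in> space M. X (k + 1) \<omega> - X k \<omega> < w} =
              1 - 2 / (real k + 1) * (\<integral>\<omega>. (1 + w * Y \<omega>) powi (-2) \<partial>N))
         \<and> \<not> stationary_increments M X"
proof (intro conjI allI impI notI)
  fix k :: nat and w :: real and N :: "'b measure" and Y
  assume k: "1 \<le> k" and w: "0 < w" and Y [measurable]: "Y \<in> borel_measurable N"
    and law: "distr N borel Y = beta_law 3 (real k - 1)"
  have "(\<integral>y. (1 + w * y) powi (-2) \<partial>beta_law 3 (real k - 1)) =
      (\<integral>\<omega>. (1 + w * Y \<omega>) powi (-2) \<partial>N)"
    unfolding law[symmetric] by (subst integral_distr) (simp_all add: power_int_minus)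
  then show "measure M {\<omega> \<in> space M. X (k + 1) \<omega> - X k \<omega> < w} =
      1 - 2 / (real k + 1) * (\<integral>\<omega>. (1 + w * Y \<omega>) powi (-2) \<partial>N)"
    using kendall_walk_increment_less[OF assms k w] by simp
next
  assume "stationary_increments M X"
  then have "increment_law M X 1 = increment_law M X 2"
    unfolding stationary_increments_def by (meson one_le_numeral order_refl)
  moreover have X [measurable]: "X n \<in> borel_measurable M" for n
    using assms by (simp add: kendall_random_walk_def)
  have "measure (increment_law M X k) {..<w} =
      measure M {\<omega> \<in> space M. X (k + 1) \<omega> - X k \<omega> < w}" for k w
    unfolding increment_law_def
    by (subst measure_distr) (auto intro!: arg_cong[where f = "measure M"])
  ultimately have eq: "measure M {\<omega> \<in> space M. X (1 + 1) \<omega> - X 1 \<omega> < w} =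
      measure M {\<omega> \<in> space M. X (2 + 1) \<omega> - X 2 \<omega> < w}" for w
    by metis
  \<comment> \<open>At \<open>w = 1 / 5\<close>: time \<open>1\<close> gives \<open>1 - (1 + w)\<^sup>-\<^sup>2 = 1 - 25 / 36\<close>, time \<open>2\<close> at least \<open>1 - 2 / 3\<close>, and \<open>2 / 3 < 25 / 36\<close>.\<close>
  let ?f = "\<lambda>y. (1 + 1 / 5 * y :: real) powi (-2)"
  have "measure M {\<omega> \<in> space M. X (1 + 1) \<omega> - X 1 \<omega> < 1 / 5} = 1 - 25 / 36"
    using kendall_walk_increment_less[OF assms, of 1 "1 / 5"]
    by (simp add: beta_law_def integral_return power_int_minus power2_eq_square)
  moreover have "measure M {\<omega> \<in> space M. X (2 + 1) \<omega> - X 2 \<omega> < 1 / 5} =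
      1 - 2 / 3 * (\<integral>y. ?f y \<partial>beta_law 3 1)"
    using kendall_walk_increment_less[OF assms, of 2 "1 / 5"] by simp
  moreover have "(\<integral>y. ?f y \<partial>beta_law 3 1) \<le> 1"
  proof -
    interpret B: prob_space "beta_law 3 1" by (rule prob_space_beta_law) simp_all
    have f: "0 \<le> ?f y \<and> ?f y \<le> 1" if "0 < y" for y :: real
      using that by (simp add: power_int_minus inverse_le_1_iff)
    have "(\<integral>y. ?f y \<partial>beta_law 3 1) \<le> (\<integral>y. 1 \<partial>beta_law 3 1)"
    proof (rule integral_mono_AE)
      show "integrable (beta_law 3 1) ?f"
        by (rule B.integrable_const_bound[where B = 1], rule AE_mp[OF AE_beta_law], rule AE_I2)
           (use f in \<open>auto simp: power_int_minus\<close>)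
      show "AE y in beta_law 3 1. ?f y \<le> 1"
        using AE_beta_law by eventually_elim (use f in auto)
    qed simp
    then show ?thesis using B.prob_space by simp
  qed
  ultimately show False using eq[of "1 / 5"] by simp
qed

end
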